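(* Let $p$ be an odd prime and let $G=D_p\times D_p$, a group of order $4p^2$. Then the spectrum of the signless Laplacian matrix $Q(\mathcal{S}_{D_p\times D_p})$, as a multiset of $4p^2$ eigenvalues, consists of: (i) $3p^2-2p-2$, taken $p^2-2$ times; (ii) $4p^2-2$, taken $2p^2-2p-1$ times; (iii) $3p^2-1$, taken $p^2+2p-1$ times; (iv) the remaining $4$ eigenvalues, which are the numbers $2\lambda$, where $\lambda$ runs over the roots (with multiplicity) of the equation $\det(M-\lambda I_4)=0$ and $M$ is the following $4\times4$ matrix with $\alpha=\tfrac12$: $$M=\begin{pmatrix} (4p^2-1)\alpha & (p^2+2p)(1-\alpha) & (2p^2-2p)(1-\alpha) & (p^2-1)(1-\alpha)\\ 1-\alpha & (p^2+2p-1)(1-\alpha)+3p^2\alpha & (2p^2-2p)(1-\alpha) & 0\\ 1-\alpha & (p^2+2p)(1-\alpha) & (2p^2-2p-1)(1-\alpha)+(4p^2-1)\alpha & (p^2-1)(1-\alpha)\\ 1-\alpha & 0 & (2p^2-2p)(1-\alpha) & (p^2-2)+(2p^2-2p+1)\alpha \end{pmatrix}.$$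
   Context: $D_n$ denotes the dihedral group of order $2n$, generated by $a,b$ with $o(a)=n$, $o(b)=2$, $ba=a^{-1}b$; $o(x)$ is the order of a group element $x$. For a finite group $G$, the superpower graph $\mathcal{S}_G$ is the simple undirected graph whose vertex set is $G$, with two distinct vertices $x,y$ adjacent if and only if $o(x)\mid o(y)$ or $o(y)\mid o(x)$. For a graph $\Gamma$ with adjacency matrix $A(\Gamma)$ and diagonal matrix of vertex degrees $D(\Gamma)$, the signless Laplacian matrix is $Q(\Gamma)=D(\Gamma)+A(\Gamma)$. The spectrum is the multiset of eigenvalues counted with multiplicity; if listed values coincide, multiplicities add. *)

theory Defs
  imports
    "HOL-Algebra.Multiplicative_Group"
    "HOL-Algebra.Generated_Groups"
    "HOL-Computational_Algebra.Fundamental_Theorem_Algebra"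
    "Graph_Theory.Pair_Digraph"
    "Jordan_Normal_Form.Char_Poly"
begin

section \<open>Dihedral groups\<close>

text \<open>
  The pair \<open>(i, s)\<close> stands for \<open>a\<^sup>i b\<^sup>s\<close>, with \<open>i\<close> an exponent modulo \<open>n\<close> and \<open>s\<close> telling whether
  the factor \<open>b\<close> is present; the product is dictated by \<open>b a = a\<^sup>-\<^sup>1 b\<close>. The lemmas below confirm the
  presentation.
\<close>

definition dihedral :: "nat \<Rightarrow> (int \<times> bool) monoid" where
  "dihedral n = \<lparr>carrier = {0..<int n} \<times> UNIV,
     monoid.mult = (\<lambda>(i, s) (j, t). ((if s then i - j else i + j) mod int n, s \<noteq> t)),
     one = (0, False)\<rparr>"

lemma dihedral_simps [simp]:
  "carrier (dihedral n) = {0..<int n} \<times> UNIV"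
  "(i, s) \<otimes>\<^bsub>dihedral n\<^esub> (j, t) = ((if s then i - j else i + j) mod int n, s \<noteq> t)"
  "\<one>\<^bsub>dihedral n\<^esub> = (0, False)"
  by (simp_all add: dihedral_def)

lemma dihedral_group:
  assumes "n > 0"
  shows "group (dihedral n)"
proof (rule groupI)
  fix x y z
  assume "x \<in> carrier (dihedral n)" "y \<in> carrier (dihedral n)" "z \<in> carrier (dihedral n)"
  then show "x \<otimes>\<^bsub>dihedral n\<^esub> y \<otimes>\<^bsub>dihedral n\<^esub> z = x \<otimes>\<^bsub>dihedral n\<^esub> (y \<otimes>\<^bsub>dihedral n\<^esub> z)"
    by (cases x; cases y; cases z) (simp add: mod_simps algebra_simps)
next
  fix x assume x: "x \<in> carrier (dihedral n)"
  obtain i s where [simp]: "x = (i, s)" by (cases x)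
  have "((if s then i else - i) mod int n, s) \<otimes>\<^bsub>dihedral n\<^esub> x = \<one>\<^bsub>dihedral n\<^esub>"
    by (auto simp: mod_simps)
  moreover have "((if s then i else - i) mod int n, s) \<in> carrier (dihedral n)"
    using assms by auto
  ultimately show "\<exists>y\<in>carrier (dihedral n). y \<otimes>\<^bsub>dihedral n\<^esub> x = \<one>\<^bsub>dihedral n\<^esub>" by blast
qed (use assms in auto)

lemma order_dihedral: "Coset.order (dihedral n) = 2 * n"
  by (simp add: Coset.order_def card_cartesian_product)

lemma dihedral_a_pow:
  assumes "n > 1"
  shows "(1, False) [^]\<^bsub>dihedral n\<^esub> (k::nat) = (int k mod int n, False)"
proof -
  interpret group "dihedral n" using assms by (intro dihedral_group) simp
  show ?thesis by (induction k) (auto simp: mod_simps algebra_simps)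
qed

lemma dihedral_presentation:
  assumes "n > 1"
  defines "D \<equiv> dihedral n" and "a \<equiv> (1, False)" and "b \<equiv> (0, True)"
  shows "group.ord D a = n" "group.ord D b = 2"
    and "b \<otimes>\<^bsub>D\<^esub> a = inv\<^bsub>D\<^esub> a \<otimes>\<^bsub>D\<^esub> b" "generate D {a, b} = carrier D"
proof -
  interpret group D unfolding D_def using assms by (intro dihedral_group) simp
  have ab: "a \<in> carrier D" "b \<in> carrier D" using assms by (auto simp: D_def a_def b_def)
  have pow: "a [^]\<^bsub>D\<^esub> (k::nat) = (int k mod int n, False)" for k
    unfolding D_def a_def using dihedral_a_pow assms by blast
  show "group.ord D a = n"
  proof (subst ord_unique[OF ab(1)], intro allI)
    fix k :: nat
    have "int k mod int n = 0 \<longleftrightarrow> n dvd k" by (simp flip: dvd_eq_mod_eq_0)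
    then show "a [^]\<^bsub>D\<^esub> k = \<one>\<^bsub>D\<^esub> \<longleftrightarrow> n dvd k" unfolding pow by (simp add: D_def)
  qed
  have b2: "b \<otimes>\<^bsub>D\<^esub> b = \<one>\<^bsub>D\<^esub>" by (simp add: D_def b_def)
  have "ord b dvd 2"
    using b2 ab by (subst pow_eq_id [symmetric]) (auto simp: numeral_2_eq_2)
  moreover have "ord b \<noteq> 1"
    using ab by (subst ord_eq_1) (auto simp: D_def b_def)
  ultimately show "group.ord D b = 2"
    using prime_nat_iff two_is_prime_nat by blast
  have "inv\<^bsub>D\<^esub> a = (int n - 1, False)"
    using assms ab by (intro inv_equality) (auto simp: D_def a_def)
  then show "b \<otimes>\<^bsub>D\<^esub> a = inv\<^bsub>D\<^esub> a \<otimes>\<^bsub>D\<^esub> b"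
    using assms by (simp add: D_def a_def b_def zmod_minus1)
  have gen_a: "a [^]\<^bsub>D\<^esub> (k::nat) \<in> generate D {a, b}" for k
    by (induction k) (auto intro: generate.intros)
  have "x \<in> generate D {a, b}" if xD: "x \<in> carrier D" for x
  proof -
    obtain i s where x: "x = (i, s)" "0 \<le> i" "i < int n" using xD by (cases x) (auto simp: D_def)
    have eq: "a [^]\<^bsub>D\<^esub> nat i = (i, False)" using x by (simp add: pow)
    have "(i, False) \<otimes>\<^bsub>D\<^esub> b \<in> generate D {a, b}"
      using gen_a[of "nat i"] eq by (auto intro: generate.intros)
    also have "(i, False) \<otimes>\<^bsub>D\<^esub> b = (i, True)" using x by (simp add: D_def b_def)
    finally show ?thesis using gen_a[of "nat i"] eq x by (cases s) auto
  qed
  moreover have "generate D {a, b} \<subseteq> carrier D" using ab by (intro generate_incl) auto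
  ultimately show "generate D {a, b} = carrier D" by blast
qed


section \<open>Superpower graphs\<close>

text \<open>
  Simple undirected graphs are symmetric, loop-free digraphs without parallel arcs, i.e. instances
  of \<^locale>\<open>pair_graph\<close>: an edge between \<open>x\<close> and \<open>y\<close> is the pair of arcs \<open>(x, y)\<close>, \<open>(y, x)\<close>.
\<close>

definition superpower_graph :: "('a, 'm) monoid_scheme \<Rightarrow> 'a pair_pre_digraph" where
  "superpower_graph G = \<lparr>pverts = carrier G,
     parcs = {(x, y). x \<in> carrier G \<and> y \<in> carrier G \<and> x \<noteq> y \<and>
       (group.ord G x dvd group.ord G y \<or> group.ord G y dvd group.ord G x)}\<rparr>"

lemma superpower_graph_pair_graph:
  assumes "finite (carrier G)"
  shows "pair_graph (superpower_graph G)"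
proof
  show "finite (parcs (superpower_graph G))"
    by (rule finite_subset[of _ "carrier G \<times> carrier G"])
       (use assms in \<open>auto simp: superpower_graph_def\<close>)
qed (use assms in \<open>auto simp: superpower_graph_def symmetric_def intro!: symI\<close>)


section \<open>Matrices of a graph and their spectrum\<close>

text \<open>
  Matrices in \<^typ>\<open>'a mat\<close> are indexed by natural numbers, so the matrices of a graph are taken
  with respect to an enumeration \<open>vs\<close> of its vertices without repetition. In a symmetric digraph
  the out-degree is the number of neighbours.
\<close>

definition adjacency_matrix :: "'v pair_pre_digraph \<Rightarrow> 'v list \<Rightarrow> 'r :: comm_ring_1 mat" where
  "adjacency_matrix \<Gamma> vs = mat (length vs) (length vs)
     (\<lambda>(i, j). if (vs ! i, vs ! j) \<in> parcs \<Gamma> then 1 else 0)"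

definition degree_matrix :: "'v pair_pre_digraph \<Rightarrow> 'v list \<Rightarrow> 'r :: comm_ring_1 mat" where
  "degree_matrix \<Gamma> vs = mat (length vs) (length vs)
     (\<lambda>(i, j). if i = j then of_nat (out_degree (with_proj \<Gamma>) (vs ! i)) else 0)"

definition signless_laplacian :: "'v pair_pre_digraph \<Rightarrow> 'v list \<Rightarrow> 'r :: comm_ring_1 mat" where
  "signless_laplacian \<Gamma> vs = degree_matrix \<Gamma> vs + adjacency_matrix \<Gamma> vs"

text \<open>
  The eigenvalues of a square matrix with their algebraic multiplicities. Working over the complex
  numbers, an \<open>n \<times> n\<close> matrix has exactly \<open>n\<close> of them.
\<close>

definition spectrum_mset :: "complex mat \<Rightarrow> complex multiset" where
  "spectrum_mset A = proots (char_poly A)"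

lemma set_spectrum_mset:
  assumes "A \<in> carrier_mat n n"
  shows "set_mset (spectrum_mset A) = {k. eigenvalue A k}"
proof -
  have "char_poly A \<noteq> 0" using degree_monic_char_poly[OF assms] by auto
  then show ?thesis
    unfolding spectrum_mset_def using eigenvalue_root_char_poly[OF assms] by simp
qed

lemma size_spectrum_mset:
  assumes "A \<in> carrier_mat n n"
  shows "size (spectrum_mset A) = n"
  unfolding spectrum_mset_def size_proots_complex using degree_monic_char_poly[OF assms] by simp

text \<open>
  Roots, with multiplicity, of the equation \<open>det (M - \<lambda> I) = 0\<close> in the unknown \<open>\<lambda>\<close>: the entries of
  \<open>M\<close> are read as constant polynomials and \<open>\<lambda>\<close> as the indeterminate.
\<close>

definition det_equation_roots :: "complex mat \<Rightarrow> complex multiset" where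
  "det_equation_roots M =
     proots (det (map_mat (\<lambda>c. [:c:]) M - [:0, 1:] \<cdot>\<^sub>m 1\<^sub>m (dim_row M)))"

text \<open>
  The quotient of \<open>\<alpha> D + (1 - \<alpha>) A\<close> for the superpower graph of \<open>D\<^sub>p \<times> D\<^sub>p\<close> by the partition of the
  group into the elements of order \<open>1\<close>, \<open>2\<close>, \<open>2p\<close>, \<open>p\<close> (in this order).
\<close>

definition M_matrix :: "'r :: field \<Rightarrow> 'r \<Rightarrow> 'r mat" where
  "M_matrix p \<alpha> = mat_of_rows_list 4
    [[(4*p^2 - 1)*\<alpha>, (p^2 + 2*p)*(1 - \<alpha>), (2*p^2 - 2*p)*(1 - \<alpha>), (p^2 - 1)*(1 - \<alpha>)],
     [1 - \<alpha>, (p^2 + 2*p - 1)*(1 - \<alpha>) + 3*p^2*\<alpha>, (2*p^2 - 2*p)*(1 - \<alpha>), 0],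
     [1 - \<alpha>, (p^2 + 2*p)*(1 - \<alpha>), (2*p^2 - 2*p - 1)*(1 - \<alpha>) + (4*p^2 - 1)*\<alpha>, (p^2 - 1)*(1 - \<alpha>)],
     [1 - \<alpha>, 0, (2*p^2 - 2*p)*(1 - \<alpha>), (p^2 - 2) + (2*p^2 - 2*p + 1)*\<alpha>]]"

end

theory Submission
  imports Defs
begin

text \<open>
  Adjacency in the superpower graph depends only on the orders of the two elements, so the signless
  Laplacian is a diagonal matrix \<open>D\<close>, constant on the order classes, plus a matrix \<open>S B S\<^sup>T\<close>, where \<open>S\<close> is
  the indicator matrix of the four classes. The identity \<open>det (P - U V) = det P \<cdot> det (1 - V P\<^sup>-\<^sup>1 U)\<close>
  with \<open>P = x I - D\<close> then expresses its characteristic polynomial by that of a \<open>4 \<times> 4\<close> quotient matrix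
  and one linear factor per class, which occurs as often as the class has elements, minus one.
\<close>

section \<open>Characteristic polynomials of block-constant matrices\<close>

text \<open>Both sides are the determinant of the block matrix \<open>?F\<close>. Its lower left
  block \<open>V\<close> can be cleared by unipotent column operations (\<open>?R\<close>) or row
  operations (\<open>?L\<close>); the two results are block triangular with different Schur
  complements on the diagonal.\<close>

lemma det_diff_mult:
  fixes P :: "'a :: idom mat"
  assumes P: "P \<in> carrier_mat n n" and P': "P' \<in> carrier_mat n n" and inv: "P' * P = 1\<^sub>m n"
    and U: "U \<in> carrier_mat n k" and V: "V \<in> carrier_mat k n"
  shows "det (P - U * V) = det P * det (1\<^sub>m k - V * P' * U)"
proof -
  let ?F = "four_block_mat P U V (1\<^sub>m k)"
  have F: "?F \<in> carrier_mat (n + k) (n + k)"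
    using P by simp
  let ?R = "four_block_mat (1\<^sub>m n) (0\<^sub>m n k) (- V) (1\<^sub>m k)"
  have R: "?R \<in> carrier_mat (n + k) (n + k)" by simp
  have "?F * ?R = four_block_mat (P - U * V) U (0\<^sub>m k n) (1\<^sub>m k)"
    using P U V by (subst mult_four_block_mat[of _ n n _ k _ k _ _ n _ k])
      (auto simp: minus_add_uminus_mat[of P n n] uminus_l_inv_mat intro!: cong_four_block_mat)
  moreover have "det ?R = 1"
    using V by (subst det_four_block_mat_upper_right_zero[of _ n _ k]) auto
  moreover have "det (four_block_mat (P - U * V) U (0\<^sub>m k n) (1\<^sub>m k)) = det (P - U * V)"
    using P U V by (subst det_four_block_mat_lower_left_zero[of _ n _ k])
      (auto intro: minus_carrier_mat)
  ultimately have 1: "det ?F = det (P - U * V)"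
    using det_mult[OF F R] by simp
  let ?L = "four_block_mat (1\<^sub>m n) (0\<^sub>m n k) (- (V * P')) (1\<^sub>m k)"
  have L: "?L \<in> carrier_mat (n + k) (n + k)" by simp
  have VP': "V * P' \<in> carrier_mat k n" using V P' by simp
  have VPP: "V * P' * P = V" using V P P' inv by (simp add: assoc_mult_mat[of V k n P' n P n])
  have "?L * ?F = four_block_mat P U (0\<^sub>m k n) (1\<^sub>m k - V * P' * U)"
    using P U V VP' VPP by (subst mult_four_block_mat[of _ n n _ k _ k _ _ n _ k])
      (auto simp: comm_add_mat[of _ k k "1\<^sub>m k"] minus_add_uminus_mat[of "1\<^sub>m k" k k]
        uminus_l_inv_mat intro!: cong_four_block_mat)
  moreover have "det ?L = 1"
    using VP' by (subst det_four_block_mat_upper_right_zero[of _ n _ k]) auto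
  moreover have "det (four_block_mat P U (0\<^sub>m k n) (1\<^sub>m k - V * P' * U)) =
      det P * det (1\<^sub>m k - V * P' * U)"
    using P U VP' by (intro det_four_block_mat_lower_left_zero)
      (auto intro: minus_carrier_mat)
  ultimately have "det ?F = det P * det (1\<^sub>m k - V * P' * U)"
    using det_mult[OF L F] by simp
  with 1 show ?thesis by simp
qed

lemma det_mat_diag: "det (mat_diag n f) = (\<Prod>i<n. f i)"
  by (subst det_upper_triangular[of _ n])
    (auto simp: mat_diag_def upper_triangular_def prod_list_diag_prod atLeast0LessThan
      intro!: prod.cong)

text \<open>A nonzero difference would have only finitely many roots in an infinite field. This
  allows a polynomial identity to be checked away from the points where an auxiliary matrix is
  singular.\<close>

lemma poly_eqI_cofinite:
  fixes p q :: "'a :: field_char_0 poly"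
  assumes "finite S" and "\<And>x. x \<notin> S \<Longrightarrow> poly p x = poly q x"
  shows "p = q"
proof (rule ccontr)
  assume "p \<noteq> q"
  then have "finite {x. poly (p - q) x = 0}" by (intro poly_roots_finite) simp
  moreover have "UNIV - S \<subseteq> {x. poly (p - q) x = 0}" using assms(2) by auto
  ultimately show False
    using assms(1) infinite_UNIV_char_0[where ?'a = 'a] finite_subset by (metis Diff_infinite_finite)
qed

text \<open>Off the values \<open>e a\<close>, the determinant of \<open>x I - D\<close> is the
  product of the \<open>(x - e a) ^ m a\<close>. One factor per class is spent on clearing the
  denominators of the \<open>k\<close> by \<open>k\<close> Schur complement, which turns it into
  \<open>x I\<close> minus the quotient matrix; the others form the linear part.\<close>

lemma char_poly_partition:
  fixes e :: "nat \<Rightarrow> 'a :: field_char_0" and B :: "nat \<Rightarrow> nat \<Rightarrow> 'a"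
  assumes c: "c ` {..<n} = {..<k}"
  defines "m \<equiv> \<lambda>a. card {i. i < n \<and> c i = a}"
  shows "char_poly (mat n n (\<lambda>(i, j). (if i = j then e (c i) else 0) + B (c i) (c j))) =
    (\<Prod>a<k. [:- e a, 1:] ^ (m a - 1)) *
    char_poly (mat k k (\<lambda>(a, b). (if a = b then e a else 0) + B a b * of_nat (m b)))"
    (is "char_poly ?A = ?r * char_poly ?Q")
proof (rule poly_eqI_cofinite)
  show "finite (e ` {..<k})" by simp
  \<comment> \<open>The excluded values are exactly those at which \<open>P\<close> is
    singular.\<close>
  fix x assume x: "x \<notin> e ` {..<k}"
  have ck: "c i < k" if "i < n" for i using c that by blast
  have m0: "m a > 0" if "a < k" for a
  proof -
    from that c obtain i where "i < n" "c i = a" by (metis imageE lessThan_iff)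
    then show ?thesis unfolding m_def by (auto simp: card_gt_0_iff)
  qed
  \<comment> \<open>\<open>U\<close> is the class indicator and \<open>V\<close> holds the columns
    of \<open>B\<close> repeated along the classes, so \<open>U * V\<close> is the block-constant
    part. \<open>W\<close> is the quotient of \<open>P\<close>, with one diagonal entry per
    class.\<close>
  define P P' U V W where
    "P = mat_diag n (\<lambda>i. x - e (c i))" and
    "P' = mat_diag n (\<lambda>i. inverse (x - e (c i)))" and
    "U = mat n k (\<lambda>(i, a). if c i = a then 1 else 0 :: 'a)" and
    "V = mat k n (\<lambda>(a, j). B a (c j))" and
    "W = mat_diag k (\<lambda>a. x - e a)"
  note defs = this
  have carr [simp]: "P \<in> carrier_mat n n" "P' \<in> carrier_mat n n" "U \<in> carrier_mat n k"
    "V \<in> carrier_mat k n" "W \<in> carrier_mat k k" by (simp_all add: defs)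
  have VPU_carr: "V * P' * U \<in> carrier_mat k k"
    by (rule mult_carrier_mat[OF mult_carrier_mat[OF carr(4,2)] carr(3)])
  have diff_carr: "1\<^sub>m k - V * P' * U \<in> carrier_mat k k"
    by (rule minus_carrier_mat[OF VPU_carr])
  have ne: "x - e a \<noteq> 0" if "a < k" for a using x that by auto
  have "P' * P = mat_diag n (\<lambda>i. 1)"
    unfolding defs mat_diag_diag unfolding mat_diag_def using ne ck by (intro cong_mat) auto
  then have inv: "P' * P = 1\<^sub>m n" by simp
  have UV: "U * V = mat n n (\<lambda>(i, j). B (c i) (c j))"
  proof (rule eq_matI, goal_cases)
    case (1 i j)
    then have "(U * V) $$ (i, j) = (\<Sum>a<k. (if c i = a then 1 else 0) * B a (c j))"
      by (simp add: defs scalar_prod_def atLeast0LessThan)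
    also have "\<dots> = (\<Sum>a<k. if c i = a then B a (c j) else 0)"
      by (intro sum.cong) auto
    finally show ?case using 1 ck by simp
  qed (simp_all add: defs)
  have "poly (char_poly ?A) x = det (P - U * V)"
    unfolding char_poly_def UV
    by (intro poly_det_cong[of _ n]) (auto simp: char_poly_matrix_def defs mat_diag_def)
  also have "\<dots> = det P * det (1\<^sub>m k - V * P' * U)"
    using det_diff_mult[OF carr(1,2) inv carr(3,4)] .
  also have "det P = (\<Prod>i<n. x - e (c i))"
    unfolding defs by (rule det_mat_diag)
  also have "\<dots> = (\<Prod>a<k. \<Prod>i | i \<in> {..<n} \<and> c i = a. x - e (c i))"
    using ck by (subst prod.group) auto
  also have "\<dots> = (\<Prod>a<k. (x - e a) ^ m a)"
    by (auto simp: m_def intro!: prod.cong)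
  \<comment> \<open>Splitting off a factor needs \<open>m a > 0\<close>, which is where surjectivity
    of \<open>c\<close> onto the classes enters.\<close>
  also have "\<dots> = (\<Prod>a<k. (x - e a) ^ (m a - 1)) * (\<Prod>a<k. x - e a)"
    unfolding prod.distrib[symmetric] by (intro prod.cong refl power_minus_mult[symmetric] m0) simp
  also have "(\<Prod>a<k. x - e a) = det W"
    unfolding defs by (rule det_mat_diag[symmetric])
  also have "(\<Prod>a<k. (x - e a) ^ (m a - 1)) * det W * det (1\<^sub>m k - V * P' * U)
      = (\<Prod>a<k. (x - e a) ^ (m a - 1)) * det ((1\<^sub>m k - V * P' * U) * W)"
    by (simp add: det_mult[OF diff_carr carr(5)])
  also have "det ((1\<^sub>m k - V * P' * U) * W) = poly (char_poly ?Q) x"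
    unfolding char_poly_def
  \<comment> \<open>Right multiplication by \<open>W\<close> scales column \<open>b\<close> by
    \<open>x - e b\<close> and so cancels the inverse in that column.\<close>
  proof (rule poly_det_cong[symmetric, of _ k])
    fix a b assume ab: "a < k" "b < k"
    have VP: "V * P' = mat k n (\<lambda>(a, i). B a (c i) * inverse (x - e (c i)))"
      unfolding defs by (subst mat_diag_mult_right[of _ k]) (auto intro!: cong_mat)
    have "(V * P' * U) $$ (a, b) = (\<Sum>i<n. if c i = b then B a b * inverse (x - e b) else 0)"
      unfolding VP using ab
      by (auto simp: defs scalar_prod_def atLeast0LessThan intro!: sum.cong)
    also have "\<dots> = of_nat (m b) * (B a b * inverse (x - e b))"
      by (subst sum.inter_filter[symmetric]) (auto simp: m_def)
    finally have VPU: "(V * P' * U) $$ (a, b) = of_nat (m b) * (B a b * inverse (x - e b))" .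
    have "(1\<^sub>m k - V * P' * U) * W =
        mat k k (\<lambda>(a, b). (1\<^sub>m k - V * P' * U) $$ (a, b) * (x - e b))"
      unfolding defs(5) by (rule mat_diag_mult_right[OF diff_carr])
    moreover have "(1\<^sub>m k - V * P' * U) $$ (a, b) =
        (if a = b then 1 else 0) - of_nat (m b) * (B a b * inverse (x - e b))"
      unfolding VPU[symmetric] using ab carrier_matD[OF VPU_carr]
      by (subst index_minus_mat(1)) (auto simp del: index_mult_mat)
    ultimately show "poly (char_poly_matrix ?Q $$ (a, b)) x =
        ((1\<^sub>m k - V * P' * U) * W) $$ (a, b)"
      using ab ne[OF ab(2)] by (auto simp: char_poly_matrix_def field_simps)
  qed (auto intro: mult_carrier_mat[OF diff_carr])
  finally show "poly (char_poly ?A) x = poly (?r * char_poly ?Q) x"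
    by (simp add: poly_prod)
qed

section \<open>Graphs whose adjacency depends only on vertex classes\<close>

lemma char_poly_signless_laplacian_partition:
  fixes \<Gamma> :: "'v pair_pre_digraph" and c :: "'v \<Rightarrow> nat"
  assumes vs: "distinct vs" "c ` set vs = {..<k}"
    and arcs: "parcs \<Gamma> = {(x, y). x \<in> set vs \<and> y \<in> set vs \<and> x \<noteq> y \<and> R (c x) (c y)}"
    and R: "\<And>a. a < k \<Longrightarrow> R a a"
  defines "m \<equiv> \<lambda>a. card {x \<in> set vs. c x = a}"
  defines "e \<equiv> \<lambda>a. of_nat (\<Sum>b | b < k \<and> R a b. m b) - 2 :: 'a :: field_char_0"
  shows "char_poly (signless_laplacian \<Gamma> vs) = (\<Prod>a<k. [:- e a, 1:] ^ (m a - 1)) *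
    char_poly (mat k k (\<lambda>(a, b). (if a = b then e a else 0) + (if R a b then of_nat (m b) else 0)))"
proof -
  let ?n = "length vs"
  let ?c = "\<lambda>i. c (vs ! i)" and ?B = "\<lambda>a b. if R a b then 1 else 0 :: 'a"
  have ck: "c x < k" if "x \<in> set vs" for x using vs(2) that by blast
  \<comment> \<open>A vertex together with its neighbours is a union of whole classes, because
    \<open>R\<close> is reflexive on them.\<close>
  have deg: "of_nat (out_degree (with_proj \<Gamma>) x) = e (c x) + 1" if x: "x \<in> set vs" for x
  proof -
    let ?N = "{y \<in> set vs. R (c x) (c y)}"
    have "out_arcs (with_proj \<Gamma>) x = Pair x ` (?N - {x})"
      using x by (auto simp: out_arcs_def arcs)
    then have "out_degree (with_proj \<Gamma>) x = card (?N - {x})"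
      by (simp add: out_degree_def card_image inj_on_def)
    moreover have "card ?N = Suc (card (?N - {x}))"
      using x R[OF ck[OF x]] by (intro card.remove) auto
    ultimately have "Suc (out_degree (with_proj \<Gamma>) x) = card ?N" by simp
    also have "?N = (\<Union>b\<in>{b. b < k \<and> R (c x) b}. {y \<in> set vs. c y = b})"
      using ck by auto
    also have "card \<dots> = (\<Sum>b | b < k \<and> R (c x) b. m b)"
      unfolding m_def by (subst card_UN_disjoint) auto
    finally have "e (c x) = of_nat (Suc (out_degree (with_proj \<Gamma>) x)) - 2"
      unfolding e_def by simp
    then show ?thesis by simp
  qed
  have "signless_laplacian \<Gamma> vs =
      mat ?n ?n (\<lambda>(i, j). (if i = j then e (?c i) else 0) + ?B (?c i) (?c j))"
    using vs(1) R ck by (intro eq_matI)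
      (auto simp: signless_laplacian_def degree_matrix_def adjacency_matrix_def deg arcs
        nth_eq_iff_index_eq)
  moreover have "?c ` {..<?n} = {..<k}"
    using vs(2) by (auto simp: set_conv_nth)
  moreover have "card {i. i < ?n \<and> ?c i = a} = m a" for a
  proof -
    have "bij_betw (nth vs) {i. i < ?n \<and> ?c i = a} {x \<in> set vs. c x = a}"
      using vs(1) by (auto simp: bij_betw_def inj_on_def nth_eq_iff_index_eq set_conv_nth)
    then show ?thesis unfolding m_def by (rule bij_betw_same_card)
  qed
  moreover have "?B a b * of_nat (m b) = (if R a b then of_nat (m b) else 0)" for a b by simp
  ultimately show ?thesis
    using char_poly_partition[of ?c ?n k e ?B] by simp
qed

section \<open>Roots of characteristic polynomials\<close>

text \<open>Follows from \<open>det (x I - k M) = k ^ n * det ((x / k) I - M)\<close>, after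
  distributing one \<open>k\<close> to each of the \<open>n\<close> linear factors. It accounts for
  the eigenvalues \<open>2 \<lambda>\<close>.\<close>

lemma proots_char_poly_smult:
  fixes M :: "complex mat"
  assumes M: "M \<in> carrier_mat n n" and k: "k \<noteq> 0"
  shows "proots (char_poly (k \<cdot>\<^sub>m M)) = image_mset ((*) k) (proots (char_poly M))"
proof -
  obtain as where as: "char_poly M = (\<Prod>a\<leftarrow>as. [:- a, 1:])" "length as = n"
    using char_poly_factorized[OF M] by blast
  have roots: "proots (\<Prod>a\<leftarrow>bs. [:- a, 1:]) = mset bs" for bs :: "complex list"
  proof (induction bs)
    case (Cons b bs)
    have "(\<Prod>a\<leftarrow>bs. [:- a, 1:]) \<noteq> 0" by (auto simp: prod_list_zero_iff)
    then have "proots ([:- b, 1:] * (\<Prod>a\<leftarrow>bs. [:- a, 1:])) =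
        proots [:- b, 1:] + proots (\<Prod>a\<leftarrow>bs. [:- a, 1:])"
      by (intro proots_mult) auto
    with Cons show ?case by simp
  qed simp
  have "char_poly (k \<cdot>\<^sub>m M) = (\<Prod>a\<leftarrow>map ((*) k) as. [:- a, 1:])"
  proof (rule poly_ext)
    fix x
    have "poly (char_poly (k \<cdot>\<^sub>m M)) x = det (- (char_matrix (k \<cdot>\<^sub>m M) x))"
      using M by (intro char_poly_matrix[of _ n]) simp
    also have "- (char_matrix (k \<cdot>\<^sub>m M) x) = k \<cdot>\<^sub>m (- (char_matrix M (x / k)))"
      using M k by (intro eq_matI) (auto simp: char_matrix_def field_simps)
    also have "det \<dots> = k ^ n * poly (char_poly M) (x / k)"
      using M by (simp add: char_poly_matrix[OF M] char_matrix_def)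
    also have "\<dots> = poly (\<Prod>a\<leftarrow>map ((*) k) as. [:- a, 1:]) x"
      unfolding as(1) as(2)[symmetric] using k
      by (induction as) (auto simp: field_simps)
    finally show "poly (char_poly (k \<cdot>\<^sub>m M)) x = \<dots>" .
  qed
  then show ?thesis using as(1) by (simp only: roots mset_map)
qed

text \<open>The two determinants differ by the sign \<open>(- 1) ^ n\<close>, which does not affect
  roots.\<close>

lemma det_equation_roots_eq_proots:
  assumes M: "M \<in> carrier_mat n n"
  shows "det_equation_roots M = proots (char_poly M)"
proof -
  have "map_mat (\<lambda>c. [:c:]) M - [:0, 1:] \<cdot>\<^sub>m 1\<^sub>m (dim_row M) = (- 1) \<cdot>\<^sub>m char_poly_matrix M"
    using M by (intro eq_matI) (auto simp: char_poly_matrix_def)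
  then have "det_equation_roots M = proots ((- 1) ^ n * char_poly M)"
    using carrier_matD[OF char_poly_matrix_closed[OF M]]
    by (simp add: det_equation_roots_def char_poly_def)
  then show ?thesis by (simp add: minus_one_power_iff)
qed

section \<open>Element orders in the product of two dihedral groups\<close>

lemma pow_DirProd: "(x, y) [^]\<^bsub>G \<times>\<times> H\<^esub> (k::nat) = (x [^]\<^bsub>G\<^esub> k, y [^]\<^bsub>H\<^esub> k)"
  by (induction k) auto

text \<open>A power of the pair is trivial iff both orders divide the exponent, that is, iff their
  lcm does; this divisibility property determines the order.\<close>

lemma ord_DirProd:
  assumes "group G" "group H" "x \<in> carrier G" "y \<in> carrier H"
  shows "group.ord (G \<times>\<times> H) (x, y) = lcm (group.ord G x) (group.ord H y)"
proof -
  interpret G: group G by fact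
  interpret H: group H by fact
  interpret GH: group "G \<times>\<times> H" by (intro DirProd_group assms)
  show ?thesis
    using assms by (subst GH.ord_unique) (auto simp: pow_DirProd G.pow_eq_id H.pow_eq_id)
qed

text \<open>Reflections square to the identity and rotations have trivial \<open>p\<close>-th power.
  Since 2 and \<open>p\<close> are prime, each order is 1 or that prime, and only the identity has
  order 1.\<close>

lemma ord_dihedral:
  assumes p: "prime p" and x: "(i, s) \<in> carrier (dihedral p)"
  shows "group.ord (dihedral p) (i, s) = (if s then 2 else if i = 0 then 1 else p)"
proof -
  interpret group "dihedral p" using p by (intro dihedral_group prime_gt_0_nat)
  have one: "ord (i, s) = 1 \<longleftrightarrow> (i, s) = (0, False)"
    using ord_eq_1[OF x] by simp
  have "ord (i, True) dvd 2" if "s"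
    using x that by (subst pow_eq_id[symmetric]) (auto simp: numeral_2_eq_2)
  moreover have "ord (i, False) dvd p" if "\<not> s"
  proof -
    have "(i, False) [^]\<^bsub>dihedral p\<^esub> k = (i * int k mod int p, False)" for k :: nat
      by (induction k) (auto simp: mod_simps algebra_simps)
    then show ?thesis
      using x that by (subst pow_eq_id[symmetric]) auto
  qed
  ultimately show ?thesis
    using one p two_is_prime_nat by (metis prime_nat_iff prod.inject)
qed

text \<open>Split each factor into the identity \<open>I\<close>, the nontrivial rotations
  \<open>N\<close> and the reflections \<open>R\<close>. On each of the nine resulting products the
  order is a constant lcm, so every order class is a disjoint union of such products.\<close>

lemma card_ord_dihedral_square:
  assumes p: "prime p" "odd p"
  defines "G \<equiv> dihedral p \<times>\<times> dihedral p"
  shows "card {x \<in> carrier G. group.ord G x = 1} = 1"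
    and "card {x \<in> carrier G. group.ord G x = 2} = p\<^sup>2 + 2 * p"
    and "card {x \<in> carrier G. group.ord G x = 2 * p} = 2 * p\<^sup>2 - 2 * p"
    and "card {x \<in> carrier G. group.ord G x = p} = p\<^sup>2 - 1"
    and "x \<in> carrier G \<Longrightarrow> group.ord G x \<in> {1, 2, 2 * p, p}"
proof -
  define I N R where "I = {(0 :: int, False)}" and "N = {1..<int p} \<times> {False}"
    and "R = {0..<int p} \<times> {True}"
  note sets = this
  have p2: "p > 2" using p prime_ge_2_nat[of p] by (cases "p = 2") auto
  have carr: "carrier (dihedral p) = I \<union> N \<union> R"
    using p2 by (auto simp: sets)
  have disj: "I \<inter> N = {}" "I \<inter> R = {}" "N \<inter> R = {}" by (auto simp: sets)
  have fin: "finite I" "finite N" "finite R" by (auto simp: sets)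
  have cards: "card I = 1" "card N = p - 1" "card R = p"
    using p2 by (auto simp: sets card_cartesian_product)
  have ords: "x \<in> I \<Longrightarrow> group.ord (dihedral p) x = 1" "x \<in> N \<Longrightarrow> group.ord (dihedral p) x = p"
    "x \<in> R \<Longrightarrow> group.ord (dihedral p) x = 2" for x
    using ord_dihedral[OF p(1)] p2 by (auto simp: sets)
  \<comment> \<open>Oddness of \<open>p\<close> makes 2 and \<open>p\<close> coprime.\<close>
  have lcm: "lcm 2 p = 2 * p" "lcm p 2 = 2 * p"
    using p by (simp_all add: lcm_coprime coprime_left_2_iff_odd coprime_right_2_iff_odd)
  have lcm_ord: "group.ord G (x, y) = lcm (group.ord (dihedral p) x) (group.ord (dihedral p) y)"
    if "x \<in> I \<union> N \<union> R" "y \<in> I \<union> N \<union> R" for x y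
    using that p2 unfolding carr[symmetric] G_def by (intro ord_DirProd dihedral_group) auto
  have ord: "x \<in> I \<Longrightarrow> y \<in> I \<Longrightarrow> group.ord G (x, y) = 1"
    "x \<in> I \<Longrightarrow> y \<in> N \<Longrightarrow> group.ord G (x, y) = p"
    "x \<in> I \<Longrightarrow> y \<in> R \<Longrightarrow> group.ord G (x, y) = 2"
    "x \<in> N \<Longrightarrow> y \<in> I \<Longrightarrow> group.ord G (x, y) = p"
    "x \<in> N \<Longrightarrow> y \<in> N \<Longrightarrow> group.ord G (x, y) = p"
    "x \<in> N \<Longrightarrow> y \<in> R \<Longrightarrow> group.ord G (x, y) = 2 * p"
    "x \<in> R \<Longrightarrow> y \<in> I \<Longrightarrow> group.ord G (x, y) = 2"
    "x \<in> R \<Longrightarrow> y \<in> N \<Longrightarrow> group.ord G (x, y) = 2 * p"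
    "x \<in> R \<Longrightarrow> y \<in> R \<Longrightarrow> group.ord G (x, y) = 2" for x y
    by (simp_all add: lcm_ord ords lcm)
  have carrG: "carrier G = (I \<union> N \<union> R) \<times> (I \<union> N \<union> R)"
    by (simp only: G_def carrier_DirProd carr)
  have ne: "1 \<noteq> p" "2 \<noteq> p" "2 * p \<noteq> p" "p \<noteq> 1" "p \<noteq> 2" "2 * p \<noteq> 2" "2 * p \<noteq> 1" "p \<noteq> 0"
    using p2 by auto
  show "x \<in> carrier G \<Longrightarrow> group.ord G x \<in> {1, 2, 2 * p, p}"
    by (cases x) (auto simp: carrG ord)
  have "{x \<in> carrier G. group.ord G x = 1} = I \<times> I"
    unfolding carrG by safe (simp_all add: ord ne del: One_nat_def)
  then show "card {x \<in> carrier G. group.ord G x = 1} = 1"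
    by (simp add: card_cartesian_product cards)
  have "{x \<in> carrier G. group.ord G x = 2} = R \<times> R \<union> (R \<times> I \<union> I \<times> R)"
    unfolding carrG by safe (simp_all add: ord ne del: One_nat_def)
  also have "card \<dots> = card (R \<times> R) + (card (R \<times> I) + card (I \<times> R))"
    using disj fin by (simp add: card_Un_disjoint Times_Int_Times Int_Un_distrib Int_commute)
  finally show "card {x \<in> carrier G. group.ord G x = 2} = p\<^sup>2 + 2 * p"
    by (simp add: card_cartesian_product cards power2_eq_square)
  have "{x \<in> carrier G. group.ord G x = 2 * p} = R \<times> N \<union> N \<times> R"
    unfolding carrG by safe (simp_all add: ord ne del: One_nat_def)
  also have "card \<dots> = card (R \<times> N) + card (N \<times> R)"
    using disj fin by (simp add: card_Un_disjoint Times_Int_Times Int_commute)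
  finally show "card {x \<in> carrier G. group.ord G x = 2 * p} = 2 * p\<^sup>2 - 2 * p"
    by (simp add: card_cartesian_product cards power2_eq_square algebra_simps)
  have "{x \<in> carrier G. group.ord G x = p} = N \<times> N \<union> (N \<times> I \<union> I \<times> N)"
    unfolding carrG by safe (simp_all add: ord ne del: One_nat_def)
  also have "card \<dots> = card (N \<times> N) + (card (N \<times> I) + card (I \<times> N))"
    using disj fin by (simp add: card_Un_disjoint Times_Int_Times Int_Un_distrib Int_commute)
  also have "\<dots> = p\<^sup>2 - 1"
    using p2 by (cases p) (simp_all add: card_cartesian_product cards power2_eq_square)
  finally show "card {x \<in> carrier G. group.ord G x = p} = p\<^sup>2 - 1" .
qed

section \<open>Assembling the spectrum\<close>

lemma proots_prod_linear_power:
  fixes e :: "'b \<Rightarrow> 'a :: field_char_0"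
  shows "proots (\<Prod>a\<in>A. [:- e a, 1:] ^ n a) = (\<Sum>a\<in>A. replicate_mset (n a) (e a))"
  by (subst proots_prod) (auto simp: proots_power intro!: sum.cong multiset_eqI)

theorem corollary3p3:
  fixes p :: nat
    and G :: "((int \<times> bool) \<times> (int \<times> bool)) monoid"
    and vs :: "((int \<times> bool) \<times> (int \<times> bool)) list"
  assumes "prime p" and "odd p"
    and "G = dihedral p \<times>\<times> dihedral p"
    and "distinct vs" and "set vs = carrier G"
  shows "Coset.order G = 4 * p^2
    \<and> size (spectrum_mset (signless_laplacian (superpower_graph G) vs)) = 4 * p^2
    \<and> size (det_equation_roots (M_matrix (of_nat p) (1/2))) = 4
    \<and> spectrum_mset (signless_laplacian (superpower_graph G) vs) =
           replicate_mset (p^2 - 2) (3 * of_nat p^2 - 2 * of_nat p - 2)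
         + replicate_mset (2 * p^2 - 2 * p - 1) (4 * of_nat p^2 - 2)
         + replicate_mset (p^2 + 2 * p - 1) (3 * of_nat p^2 - 1)
         + image_mset (\<lambda>x. 2 * x) (det_equation_roots (M_matrix (of_nat p) (1/2)))"
proof -
  note G = assms(3) and vs = assms(4,5)
  let ?Q = "signless_laplacian (superpower_graph G) vs :: complex mat"
  let ?M = "M_matrix (of_nat p) (1/2) :: complex mat"
  let ?P = "of_nat p :: complex"
  have p2: "p > 2" using assms(1,2) prime_ge_2_nat[of p] by (cases "p = 2") auto
  \<comment> \<open>These bounds make the class sizes positive and their natural-number subtractions
    exact.\<close>
  have pp: "2 * p \<le> 2 * p\<^sup>2" "1 \<le> p\<^sup>2" "2 * p < 2 * p\<^sup>2" "1 < p\<^sup>2"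
    using p2 mult_le_mono[of 2 p 2 p] by (auto simp: power2_eq_square)
  note ords = card_ord_dihedral_square[OF assms(1,2), folded G]
  have order: "Coset.order G = 4 * p\<^sup>2"
    by (simp add: Coset.order_def G card_cartesian_product power2_eq_square)
  have len: "length vs = 4 * p\<^sup>2"
    using order distinct_card[OF vs(1)] vs(2) by (simp add: Coset.order_def)
  have Q: "?Q \<in> carrier_mat (4 * p\<^sup>2) (4 * p\<^sup>2)"
    by (simp add: signless_laplacian_def degree_matrix_def adjacency_matrix_def len)
  have M: "?M \<in> carrier_mat 4 4"
    by (rule carrier_matI) (simp_all add: M_matrix_def mat_of_rows_list_def)
  have nz: "char_poly A \<noteq> 0" if "A \<in> carrier_mat n n" for A :: "complex mat" and n
    using degree_monic_char_poly[OF that] by auto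

  \<comment> \<open>The numbering follows the rows of \<open>M_matrix\<close>: orders 1, 2,
    \<open>2 * p\<close>, \<open>p\<close>. On the group, the default value 3 means order
    \<open>p\<close>.\<close>
  define c where "c x = (if group.ord G x = 1 then 0 else if group.ord G x = 2 then 1
    else if group.ord G x = 2 * p then 2 else 3 :: nat)" for x
  \<comment> \<open>Among the four orders only 2 and \<open>p\<close>, the classes 1 and 3, are
    incomparable under divisibility.\<close>
  define R :: "nat \<Rightarrow> nat \<Rightarrow> bool" where "R a b \<longleftrightarrow> {a, b} \<noteq> {1, 3}" for a b
  have ne: "p \<noteq> 1" "p \<noteq> 2" "2 * p \<noteq> p" "2 * p \<noteq> 2" "2 * p \<noteq> 1" "p \<noteq> 0"
    using p2 by auto
  have c: "(c x = 0 \<longleftrightarrow> group.ord G x = 1) \<and> (c x = 1 \<longleftrightarrow> group.ord G x = 2) \<and>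
      (c x = 2 \<longleftrightarrow> group.ord G x = 2 * p) \<and> (c x = 3 \<longleftrightarrow> group.ord G x = p)"
    if "x \<in> set vs" for x
    using ords(5)[of x] that vs(2) ne by (auto simp: c_def)
  define m where "m = (\<lambda>a. card {x \<in> set vs. c x = a})"
  have "{x \<in> set vs. c x = 0} = {x \<in> carrier G. group.ord G x = 1}"
    "{x \<in> set vs. c x = 1} = {x \<in> carrier G. group.ord G x = 2}"
    "{x \<in> set vs. c x = 2} = {x \<in> carrier G. group.ord G x = 2 * p}"
    "{x \<in> set vs. c x = 3} = {x \<in> carrier G. group.ord G x = p}"
    using c vs(2) by blast+
  then have m: "m 0 = 1" "m 1 = p\<^sup>2 + 2 * p" "m 2 = 2 * p\<^sup>2 - 2 * p" "m 3 = p\<^sup>2 - 1"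
    by (simp_all only: m_def ords(1-4))
  have m3: "m 3 - Suc 0 = p\<^sup>2 - 2" by (simp add: m(4))
  have four: "{..<4} = {0, 1, 2, 3 :: nat}" by auto
  have classes: "c ` set vs = {..<4}"
  proof
    show "c ` set vs \<subseteq> {..<4}" by (auto simp: c_def)
    show "{..<4} \<subseteq> c ` set vs"
    proof
      fix a :: nat assume "a \<in> {..<4}"
      then have "m a > 0" unfolding four using m pp p2 by auto
      then have "{x \<in> set vs. c x = a} \<noteq> {}" unfolding m_def by (metis card.empty less_irrefl)
      then show "a \<in> c ` set vs" by auto
    qed
  qed
  have adj: "(group.ord G x dvd group.ord G y \<or> group.ord G y dvd group.ord G x) = R (c x) (c y)"
    if "x \<in> carrier G" "y \<in> carrier G" for x y
  proof -
    have "\<not> 2 dvd p" "\<not> p dvd 2" using assms(2) p2 by (auto dest: dvd_imp_le)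
    then show ?thesis
      using ords(5)[OF that(1)] ords(5)[OF that(2)] ne
      by (auto simp: c_def R_def doubleton_eq_iff)
  qed
  have arcs: "parcs (superpower_graph G) =
      {(x, y). x \<in> set vs \<and> y \<in> set vs \<and> x \<noteq> y \<and> R (c x) (c y)}"
    unfolding superpower_graph_def vs(2) by (simp add: adj cong: conj_cong)
  define e where "e a = of_nat (\<Sum>b | b < 4 \<and> R a b. m b) - (2::complex)" for a
  have of_nat_m: "of_nat (m 0) = (1::complex)" "of_nat (m 1) = ?P\<^sup>2 + 2 * ?P"
    "of_nat (m 2) = 2 * ?P\<^sup>2 - 2 * ?P" "of_nat (m 3) = ?P\<^sup>2 - 1"
    unfolding m using pp by (simp_all add: of_nat_diff)
  have "e a = (\<Sum>b<4. if R a b then of_nat (m b) else 0) - 2" for a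
    unfolding e_def by (simp add: sum.inter_filter[symmetric])
  \<comment> \<open>Classes 0 and 2 are joined to the whole group, which gives
    \<open>4 * ?P\<^sup>2 - 2\<close>. Class 1 misses the \<open>p\<^sup>2 - 1\<close> elements of
    order \<open>p\<close>, and class 3 misses the \<open>p\<^sup>2 + 2 * p\<close> elements of
    order 2.\<close>
  then have e: "e 0 = 4 * ?P\<^sup>2 - 2" "e 1 = 3 * ?P\<^sup>2 - 1" "e 2 = 4 * ?P\<^sup>2 - 2"
    "e 3 = 3 * ?P\<^sup>2 - 2 * ?P - 2"
    by (simp_all add: four of_nat_m[unfolded One_nat_def] R_def doubleton_eq_iff)
  \<comment> \<open>At \<alpha> = 1/2 the matrix \<alpha> D + (1 - \<alpha>) A is half of the
    signless Laplacian, hence the factor 2 between the quotients.\<close>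
  have T: "mat 4 4 (\<lambda>(a, b). (if a = b then e a else 0) + (if R a b then of_nat (m b) else 0))
      = 2 \<cdot>\<^sub>m ?M" (is "?T = _")
  proof (rule eq_matI)
    fix a b assume "a < dim_row (2 \<cdot>\<^sub>m ?M)" "b < dim_col (2 \<cdot>\<^sub>m ?M)"
    then have "a \<in> {0, 1, 2, 3}" "b \<in> {0, 1, 2, 3}" using M unfolding four[symmetric] by auto
    then show "?T $$ (a, b) = (2 \<cdot>\<^sub>m ?M) $$ (a, b)"
      by (auto simp: M_matrix_def mat_of_rows_list_def e[unfolded One_nat_def]
        of_nat_m[unfolded One_nat_def] R_def doubleton_eq_iff field_simps)
  qed (use M in auto)
  have "char_poly ?Q = (\<Prod>a<4. [:- e a, 1:] ^ (m a - 1)) * char_poly (2 \<cdot>\<^sub>m ?M)"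
    unfolding T[symmetric] e_def m_def
    using char_poly_signless_laplacian_partition[OF vs(1) classes arcs, where ?'a = complex]
    by (simp add: R_def)
  also have "proots \<dots> = (\<Sum>a<4. replicate_mset (m a - 1) (e a)) + proots (char_poly (2 \<cdot>\<^sub>m ?M))"
    using M nz[of "2 \<cdot>\<^sub>m ?M" 4]
    by (subst proots_mult) (auto simp: proots_prod_linear_power)
  also have "proots (char_poly (2 \<cdot>\<^sub>m ?M)) = image_mset (\<lambda>x. 2 * x) (det_equation_roots ?M)"
    using proots_char_poly_smult[OF M, of 2] det_equation_roots_eq_proots[OF M] by simp
  \<comment> \<open>The identity is alone in its class, so \<open>m 0 - 1 = 0\<close> and
    \<open>e 0\<close> contributes nothing; the copies of \<open>4 * ?P\<^sup>2 - 2\<close> listed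
    separately all come from class 2.\<close>
  finally have "spectrum_mset ?Q = replicate_mset (p^2 - 2) (3 * of_nat p^2 - 2 * of_nat p - 2)
         + replicate_mset (2 * p^2 - 2 * p - 1) (4 * of_nat p^2 - 2)
         + replicate_mset (p^2 + 2 * p - 1) (3 * of_nat p^2 - 1)
         + image_mset (\<lambda>x. 2 * x) (det_equation_roots ?M)"
    unfolding spectrum_mset_def four
    using m3 by (simp add: m(1-3)[unfolded One_nat_def] e[unfolded One_nat_def] ac_simps)
  moreover have "size (det_equation_roots ?M) = 4"
    using size_spectrum_mset[OF M] det_equation_roots_eq_proots[OF M] by (simp add: spectrum_mset_def)
  ultimately show ?thesis using order size_spectrum_mset[OF Q] by simp
qed

end
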